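(* Let $n\ge 1$ be an integer, $0<r<1$, $\alpha\in\mathbb{R}$, and let $\omega_j=e^{2\pi i j/n}$, $j=0,1,\dots,n-1$, be the $n$-th roots of unity. Let $B$ be the Blaschke product with the zeros $a_k=re^{i\alpha}\omega_k$, $k=0,\dots,n-1$, namely $$B(z)=e^{-in\alpha}\,\frac{z^n-r^ne^{in\alpha}}{e^{-in\alpha}r^nz^n-1}.$$ Then the domains bounded by consecutive rays $$z_k(t)=e^{i[\alpha+(2k+1)\pi/n]}\,t,\qquad t\ge 0,\quad k=0,1,\dots,n-1,$$ are fundamental domains of $(\widehat{\mathbb{C}},B)$. The image under $B$ of every one of these domains is the (extended) $w$-plane $\widehat{\mathbb{C}}$ from which the interval $[r^n,1/r^n]$ of the real axis has been removed. The covering transformations of $(\widehat{\mathbb{C}},B)$ are the rotations $T_j(z)=\omega_jz$, $j=0,1,\dots,n-1$.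
   Context: $\widehat{\mathbb{C}}=\mathbb{C}\cup\{\infty\}$ is the Riemann sphere, and $(\widehat{\mathbb{C}},B)$ denotes $\widehat{\mathbb{C}}$ viewed as a (branched) covering Riemann surface of $\widehat{\mathbb{C}}$ with projection $w=B(z)$. A fundamental domain of $(\widehat{\mathbb{C}},B)$ is a domain $\Omega\subset\widehat{\mathbb{C}}$ that is mapped conformally (i.e. holomorphically and injectively) by $B$ onto $\widehat{\mathbb{C}}$ from which a slit (a closed arc) has been removed. The domains bounded by consecutive rays are the open sectors with vertex at the origin, i.e. the connected components of the complement in $\mathbb{C}$ of the union of the $n$ rays. A covering transformation of $(\widehat{\mathbb{C}},B)$ is a conformal automorphism $T$ of $\widehat{\mathbb{C}}$ with $B\circ T=B$. *)

theory Defs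
  imports "HOL-Complex_Analysis.Complex_Analysis"
begin

text \<open>The Riemann sphere: the point at infinity is \<^term>\<open>None\<close>.\<close>

type_synonym sphere = "complex option"

abbreviation sphere_topology :: "sphere topology" where
  "sphere_topology \<equiv> Alexandroff_compactification euclidean"

text \<open>The holomorphic structure is given by the inverses of the two charts \<open>z\<close> and \<open>1/z\<close>.\<close>

definition sphere_params :: "(complex \<Rightarrow> sphere) set" where
  "sphere_params = {Some, \<lambda>w. if w = 0 then None else Some (inverse w)}"

definition sphere_holomorphic_on :: "(sphere \<Rightarrow> sphere) \<Rightarrow> sphere set \<Rightarrow> bool" where
  "sphere_holomorphic_on f U \<longleftrightarrow>
     openin sphere_topology U \<and>
     continuous_map (subtopology sphere_topology U) sphere_topology f \<and>
     (\<forall>\<sigma>\<in>sphere_params. \<forall>\<tau>\<in>sphere_params.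
        (\<lambda>z. inv \<tau> (f (\<sigma> z))) holomorphic_on {z. \<sigma> z \<in> U \<and> f (\<sigma> z) \<in> range \<tau>})"

definition conformal_on :: "(sphere \<Rightarrow> sphere) \<Rightarrow> sphere set \<Rightarrow> bool" where
  "conformal_on f U \<longleftrightarrow> sphere_holomorphic_on f U \<and> inj_on f U"

definition sphere_domain :: "sphere set \<Rightarrow> bool" where
  "sphere_domain U \<longleftrightarrow>
     openin sphere_topology U \<and> connectedin sphere_topology U \<and> U \<noteq> {}"

definition slit :: "sphere set \<Rightarrow> bool" where
  "slit L \<longleftrightarrow>
     subtopology sphere_topology L homeomorphic_space top_of_set {0..1::real}"

definition fundamental_domain :: "(sphere \<Rightarrow> sphere) \<Rightarrow> sphere set \<Rightarrow> bool" where
  "fundamental_domain f \<Omega> \<longleftrightarrow>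
     sphere_domain \<Omega> \<and> conformal_on f \<Omega> \<and> (\<exists>L. slit L \<and> f ` \<Omega> = UNIV - L)"

definition covering_transformations :: "(sphere \<Rightarrow> sphere) \<Rightarrow> (sphere \<Rightarrow> sphere) set" where
  "covering_transformations f = {T. conformal_on T UNIV \<and> surj T \<and> f \<circ> T = f}"

definition unity_root :: "nat \<Rightarrow> nat \<Rightarrow> complex" where
  "unity_root n j = exp (2 * of_real pi * \<i> * of_nat j / of_nat n)"

text \<open>The map is extended to the sphere by the value infinity at the zeros of the denominator
  (where the numerator does not vanish if \<open>n \<ge> 1\<close> and \<open>0 < r < 1\<close>) and by its limit \<open>1 / r\<^sup>n\<close>
  at infinity.\<close>

definition blaschke :: "nat \<Rightarrow> real \<Rightarrow> real \<Rightarrow> sphere \<Rightarrow> sphere" where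
  "blaschke n r \<alpha> p =
     (case p of
        None \<Rightarrow> Some (1 / of_real r ^ n)
      | Some z \<Rightarrow>
          (let d = exp (- (\<i> * of_nat n * of_real \<alpha>)) * of_real r ^ n * z ^ n - 1
           in if d = 0 then None
              else Some (exp (- (\<i> * of_nat n * of_real \<alpha>)) *
                         ((z ^ n - of_real r ^ n * exp (\<i> * of_nat n * of_real \<alpha>)) / d))))"

definition ray :: "nat \<Rightarrow> real \<Rightarrow> nat \<Rightarrow> complex set" where
  "ray n \<alpha> k =
     {exp (\<i> * of_real (\<alpha> + (2 * real k + 1) * pi / real n)) * of_real t |t. t \<ge> 0}"

definition rotation :: "complex \<Rightarrow> sphere \<Rightarrow> sphere" where
  "rotation \<omega> = map_option (\<lambda>z. \<omega> * z)"

text \<open>\<open>blaschke_eq_prod\<close> identifies the formula with the normalized Blaschke product with zeros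
  \<open>a k\<close>, and \<open>blaschke_limit\<close> justifies the value at infinity.\<close>

lemma unity_root_cis: "unity_root n j = cis (2 * pi * real j / real n)"
  by (simp add: unity_root_def cis_conv_exp mult_ac)

lemma prod_unity_root_diff:
  assumes "n \<ge> 1"
  shows "(\<Prod>k<n. z - c * unity_root n k) = z ^ n - c ^ n"
proof (cases "c = 0")
  case True
  then show ?thesis using assms by simp
next
  case False
  have "unity_root n = (\<lambda>k. cis (2 * pi * real k / real n))"
    by (rule ext) (rule unity_root_cis)
  then have bij: "bij_betw (unity_root n) {..<n} {z. z ^ n = 1}"
    using Complex.bij_betw_roots_unity[of n] assms by simp
  then have inj: "inj_on (\<lambda>k. c * unity_root n k) {..<n}"
    using False by (simp add: bij_betw_def inj_on_def)
  have roots: "(c * unity_root n k) ^ n = c ^ n" if "k < n" for k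
    using bij_betwE[OF bij] that by (simp add: power_mult_distrib)
  have deg: "degree (\<Prod>k<n. [:- (c * unity_root n k), 1:]) = n"
    by (subst degree_prod_sum_eq) auto
  have deg': "degree (monom 1 n - [:c ^ n:]) \<le> n"
    by (intro degree_diff_le) (auto simp: degree_monom_le)
  have "(\<Prod>k<n. [:- (c * unity_root n k), 1:]) = monom 1 n - [:c ^ n:]"
  proof (rule poly_eqI_degree_lead_coeff[where n = n and A = "(\<lambda>k. c * unity_root n k) ` {..<n}"])
    have "lead_coeff (\<Prod>k<n. [:- (c * unity_root n k), 1:]) = 1"
      by (simp add: lead_coeff_prod)
    then show "coeff (\<Prod>k<n. [:- (c * unity_root n k), 1:]) n = coeff (monom 1 n - [:c ^ n:]) n"
      using assms deg by (cases n) auto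
  next
    fix x assume "x \<in> (\<lambda>k. c * unity_root n k) ` {..<n}"
    then obtain k where k: "k < n" "x = c * unity_root n k" by auto
    then have "poly (\<Prod>k<n. [:- (c * unity_root n k), 1:]) x = 0"
      by (auto simp: poly_prod intro!: bexI[of _ k])
    then show "poly (\<Prod>k<n. [:- (c * unity_root n k), 1:]) x = poly (monom 1 n - [:c ^ n:]) x"
      using roots[OF k(1)] k by (simp add: poly_monom)
  qed (use deg deg' inj in \<open>auto simp: card_image\<close>)
  from arg_cong[OF this, of "\<lambda>p. poly p z"] show ?thesis
    by (simp add: poly_prod poly_monom)
qed

lemma blaschke_eq_prod:
  fixes z :: complex and \<alpha> :: real
  assumes "n \<ge> 1" and "r > 0"
  defines "a \<equiv> \<lambda>k. of_real r * exp (\<i> * of_real \<alpha>) * unity_root n k"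
  assumes nz: "\<forall>k<n. cnj (a k) * z \<noteq> 1"
  shows "blaschke n r \<alpha> (Some z) =
    Some (\<Prod>k<n. cnj (a k) / of_real (cmod (a k)) * ((a k - z) / (1 - cnj (a k) * z)))"
proof -
  define c where "c = of_real r * exp (\<i> * of_real \<alpha>)"
  have a: "a k = c * unity_root n k" for k by (simp add: a_def c_def)
  have norm: "cmod (a k) = r" for k using assms(2) by (simp add: a_def unity_root_cis norm_mult)
  have cn: "c ^ n = of_real r ^ n * exp (\<i> * of_nat n * of_real \<alpha>)"
    by (simp add: c_def power_mult_distrib exp_of_nat_mult[symmetric] mult_ac)
  have ccn: "cnj c ^ n = exp (- (\<i> * of_nat n * of_real \<alpha>)) * of_real r ^ n"
    using arg_cong[OF cn, of cnj] by (simp add: exp_cnj)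
  have num: "(\<Prod>k<n. a k - z) = (-1) ^ n * (z ^ n - c ^ n)"
  proof -
    have "(\<Prod>k<n. a k - z) = (\<Prod>k<n. (-1) * (z - c * unity_root n k))"
      by (simp add: a)
    then show ?thesis using prod_unity_root_diff[OF assms(1), of z c]
      by (simp only: prod.distrib) simp
  qed
  have "(\<Prod>k<n. 1 - cnj (a k) * z) = cnj (\<Prod>k<n. 1 - (c * cnj z) * unity_root n k)"
    by (simp add: a mult_ac)
  also have "\<dots> = 1 - cnj c ^ n * z ^ n"
    using prod_unity_root_diff[OF assms(1), of 1 "c * cnj z"] by (simp add: power_mult_distrib)
  finally have den: "(\<Prod>k<n. 1 - cnj (a k) * z) = 1 - cnj c ^ n * z ^ n" .
  have "(-1) ^ n * (\<Prod>k<n. unity_root n k) = -1"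
    using prod_unity_root_diff[OF assms(1), of 0 1] assms(1) by (simp add: prod_uminus)
  then have "cnj ((-1) ^ n * (\<Prod>k<n. unity_root n k)) = cnj (-1)" by simp
  then have u: "(-1) ^ n * (\<Prod>k<n. cnj (unity_root n k)) = -1" by simp
  have "(\<Prod>k<n. cnj (a k) / of_real (cmod (a k))) =
      (\<Prod>k<n. exp (- (\<i> * of_real \<alpha>)) * cnj (unity_root n k))"
    using assms(2) by (simp add: norm) (simp add: a_def exp_cnj)
  also have "\<dots> = exp (- (\<i> * of_nat n * of_real \<alpha>)) * (\<Prod>k<n. cnj (unity_root n k))"
    by (simp add: prod.distrib exp_of_nat_mult[symmetric] mult_ac)
  finally have sg: "(\<Prod>k<n. cnj (a k) / of_real (cmod (a k))) = \<dots>" .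
  have nz': "1 - cnj c ^ n * z ^ n \<noteq> 0"
    using nz unfolding den[symmetric] by auto
  have "(\<Prod>k<n. cnj (a k) / of_real (cmod (a k)) * ((a k - z) / (1 - cnj (a k) * z))) =
     exp (- (\<i> * of_nat n * of_real \<alpha>)) * ((-1) ^ n * (\<Prod>k<n. cnj (unity_root n k))) *
       (z ^ n - c ^ n) / (1 - cnj c ^ n * z ^ n)"
    (is "?lhs = _")
  proof -
    have split: "(\<Prod>k<n. s k * (x k / y k)) = (\<Prod>k<n. s k) * ((\<Prod>k<n. x k) / (\<Prod>k<n. y k))"
      for s x y :: "nat \<Rightarrow> complex" by (simp add: prod.distrib prod_dividef)
    show ?thesis
      unfolding split[of "\<lambda>k. cnj (a k) / of_real (cmod (a k))" "\<lambda>k. a k - z"] den num sg by simp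
  qed
  also have "\<dots> = exp (- (\<i> * of_nat n * of_real \<alpha>)) * ((z ^ n - c ^ n) / (cnj c ^ n * z ^ n - 1))"
    unfolding u using nz' by (simp add: divide_simps) (simp add: algebra_simps)
  finally show ?thesis
    using nz' unfolding blaschke_def ccn cn by (simp add: Let_def mult_ac)
qed

lemma blaschke_limit:
  assumes "n \<ge> 1" and "r > 0"
  shows "((\<lambda>z. exp (- (\<i> * of_nat n * of_real \<alpha>)) *
     ((z ^ n - of_real r ^ n * exp (\<i> * of_nat n * of_real \<alpha>)) /
      (exp (- (\<i> * of_nat n * of_real \<alpha>)) * of_real r ^ n * z ^ n - 1)))
     \<longlongrightarrow> 1 / of_real r ^ n) at_infinity" (is "(?f \<longlongrightarrow> _) _")
proof -
  define e where "e = exp (- (\<i> * of_nat n * of_real \<alpha>))"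
  define d where "d = of_real r ^ n * exp (\<i> * of_nat n * of_real \<alpha>)"
  have "((\<lambda>z::complex. inverse z ^ n) \<longlongrightarrow> 0 ^ n) at_infinity"
    by (intro tendsto_intros tendsto_inverse_0)
  then have i: "((\<lambda>z::complex. inverse z ^ n) \<longlongrightarrow> 0) at_infinity" using assms by (simp add: power_0_left)
  have "((\<lambda>z. e * ((1 - d * inverse z ^ n) / (e * of_real r ^ n - inverse z ^ n)))
     \<longlongrightarrow> e * ((1 - d * 0) / (e * of_real r ^ n - 0))) at_infinity"
    by (intro tendsto_intros i) (use assms in \<open>simp add: e_def\<close>)
  moreover have "e * ((1 - d * 0) / (e * of_real r ^ n - 0)) = 1 / of_real r ^ n"
    by (simp add: e_def)
  moreover have "eventually (\<lambda>z. e * ((1 - d * inverse z ^ n) / (e * of_real r ^ n - inverse z ^ n)) = ?f z) at_infinity"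
    unfolding e_def[symmetric] d_def[symmetric]
  proof (rule eventually_mono[OF eventually_not_equal_at_infinity[of 0]])
    fix z :: complex assume "z \<noteq> 0"
    then have "1 - d * inverse z ^ n = (z ^ n - d) * inverse z ^ n"
      "e * of_real r ^ n - inverse z ^ n = (e * of_real r ^ n * z ^ n - 1) * inverse z ^ n"
      by (auto simp: field_simps)
    with \<open>z \<noteq> 0\<close> show "e * ((1 - d * inverse z ^ n) / (e * of_real r ^ n - inverse z ^ n)) =
        e * ((z ^ n - d) / (e * of_real r ^ n * z ^ n - 1))" by simp
  qed
  ultimately show ?thesis by (simp only: tendsto_cong)
qed
end

theory Submission
  imports Defs
begin

text \<open>With \<open>u = e\<^sup>-\<^sup>i\<^sup>n\<^sup>\<alpha> z\<^sup>n\<close> and \<open>\<rho> = r\<^sup>n\<close> the Blaschke product becomes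
  \<open>(u - \<rho>) / (\<rho> u - 1)\<close>, an involution of the sphere that exchanges the arc from \<open>0\<close> to infinity
  along the negative real axis with \<open>[\<rho>, 1 / \<rho>]\<close>. The rays are the preimage of the nonpositive
  reals under \<open>z \<mapsto> u\<close>. On a component \<open>D\<close> of their complement, the quotient of \<open>z\<close> by a principal
  \<open>n\<close>-th root of \<open>e\<^sup>i\<^sup>n\<^sup>\<alpha> u\<close> is continuous with values in the \<open>n\<close>-th roots of unity, hence constant, so
  \<open>z \<mapsto> u\<close> maps \<open>D\<close> bijectively onto the slit plane. The same argument applied to \<open>T z / z\<close> on the
  punctured plane shows that a covering transformation \<open>T\<close> is a rotation.\<close>

section \<open>Holomorphic maps of the sphere\<close>

definition chart_at_infinity :: "complex \<Rightarrow> sphere" where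
  "chart_at_infinity w = (if w = 0 then None else Some (inverse w))"

lemma sphere_params_eq: "sphere_params = {Some, chart_at_infinity}"
  by (auto simp: sphere_params_def chart_at_infinity_def fun_eq_iff)

lemma inj_chart_at_infinity: "inj chart_at_infinity"
  by (auto simp: inj_def chart_at_infinity_def split: if_splits)

lemma range_chart_at_infinity: "range chart_at_infinity = - {Some 0}"
proof -
  have "p \<in> range chart_at_infinity" if "p \<noteq> Some 0" for p
  proof (cases p)
    case None
    then show ?thesis by (auto simp: chart_at_infinity_def image_iff intro!: exI[of _ 0])
  next
    case (Some z)
    with that show ?thesis
      by (auto simp: chart_at_infinity_def image_iff intro!: exI[of _ "inverse z"])
  qed
  then show ?thesis by (auto simp: chart_at_infinity_def split: if_splits)
qed

lemma inv_Some [simp]: "inv Some (Some z) = z"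
  by (rule inv_f_f) (rule inj_Some)

lemma inv_chart_at_infinity_None [simp]: "inv chart_at_infinity None = 0"
  by (rule inv_f_eq[OF inj_chart_at_infinity]) (simp add: chart_at_infinity_def)

lemma inv_chart_at_infinity_Some [simp]: "z \<noteq> 0 \<Longrightarrow> inv chart_at_infinity (Some z) = inverse z"
  by (rule inv_f_eq[OF inj_chart_at_infinity]) (simp add: chart_at_infinity_def)

section \<open>Open sets of the sphere in the two charts\<close>

lemma open_inverse_vimage: "open V \<Longrightarrow> open {w::complex. w \<noteq> 0 \<and> inverse w \<in> V}"
proof -
  assume "open V"
  have "continuous_on (-{0::complex}) inverse" by (intro continuous_intros) auto
  then have "open (-{0} \<inter> inverse -` V)"
    using \<open>open V\<close> by (intro continuous_open_preimage) auto
  then show ?thesis by (simp add: vimage_def Int_def)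
qed

lemma sphere_open_cases:
  assumes "openin sphere_topology V"
  obtains W where "open W" "V = Some ` W"
  | C where "compact C" "V = insert None (Some ` (- C))"
  using assms by (auto simp: openin_Alexandroff_compactification Compl_eq_Diff_UNIV)

lemma openin_sphere_insert_None:
  "compact C \<Longrightarrow> openin sphere_topology (insert None (Some ` (- C)))"
  unfolding openin_Alexandroff_compactification
  by (auto simp: Compl_eq_Diff_UNIV dest: compact_imp_closed)

text \<open>An open set containing infinity omits only a compact, hence bounded, set, and inversion
  keeps a bounded set away from \<open>0\<close>.\<close>

lemma open_vimage_chart_at_infinity:
  assumes "openin sphere_topology V"
  shows "open (chart_at_infinity -` V)"
  using assms
proof (cases rule: sphere_open_cases)
  case (1 W)
  then have "chart_at_infinity -` V = {w. w \<noteq> 0 \<and> inverse w \<in> W}"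
    by (auto simp: chart_at_infinity_def split: if_splits)
  with 1 show ?thesis by (simp add: open_inverse_vimage)
next
  case (2 C)
  then obtain R where R: "R > 0" "\<And>z. z \<in> C \<Longrightarrow> norm z \<le> R"
    by (meson bounded_pos compact_imp_bounded)
  have "inverse w \<notin> C" if "w \<noteq> 0" "norm w < inverse R" for w
  proof
    assume "inverse w \<in> C"
    then have "inverse (norm w) \<le> R" using R(2) by (metis norm_inverse)
    then show False using that R(1) by (simp add: field_simps)
  qed
  \<comment> \<open>The ball supplies a neighbourhood of \<open>0\<close>, the coordinate of
    infinity, which the second set leaves out.\<close>
  then have "chart_at_infinity -` V = ball 0 (inverse R) \<union> {w. w \<noteq> 0 \<and> inverse w \<in> - C}"
    using 2(2) R(1) by (auto simp: chart_at_infinity_def split: if_splits)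
  then show ?thesis using 2(1) by (simp only:) (intro open_Un open_ball open_inverse_vimage open_Compl compact_imp_closed)
qed

lemma openin_chart_at_infinity_image:
  assumes "open W"
  shows "openin sphere_topology (chart_at_infinity ` W)"
proof (cases "0 \<in> W")
  case True
  \<comment> \<open>\<open>z = 0\<close> is listed separately because \<open>inverse 0 = 0\<close>
    lies in \<open>W\<close>, although \<open>Some 0\<close> is not in the range of the
    chart.\<close>
  define C where "C = {z. z = 0 \<or> inverse z \<notin> W}"
  obtain e where e: "e > 0" "ball 0 e \<subseteq> W" using assms True openE by blast
  have "norm z \<le> inverse e" if "z \<in> C" for z
  proof (cases "z = 0")
    case False
    then have "inverse z \<notin> ball 0 e" using that e(2) by (auto simp: C_def)
    then show ?thesis using False e(1) by (simp add: norm_divide field_simps)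
  qed (use e in auto)
  then have "bounded C" by (auto simp: bounded_iff)
  moreover have "- C = {z. z \<noteq> 0 \<and> inverse z \<in> W}" by (auto simp: C_def)
  then have "closed C" using open_inverse_vimage[OF assms] by (simp add: closed_def)
  ultimately have "compact C" by (simp add: compact_eq_bounded_closed)
  moreover have "chart_at_infinity ` W = insert None (Some ` (- C))"
  proof -
    have "Some z \<in> chart_at_infinity ` W" if "z \<noteq> 0" "inverse z \<in> W" for z
      using that by (auto simp: chart_at_infinity_def image_iff intro!: bexI[of _ "inverse z"])
    moreover have "None \<in> chart_at_infinity ` W"
      using True by (auto simp: chart_at_infinity_def image_iff)
    ultimately show ?thesis by (auto simp: C_def chart_at_infinity_def)
  qed
  ultimately show ?thesis using openin_sphere_insert_None by simp
next
  case False
  have "chart_at_infinity ` W = Some ` {z. z \<noteq> 0 \<and> inverse z \<in> W}"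
  proof -
    have "Some z \<in> chart_at_infinity ` W" if "z \<noteq> 0" "inverse z \<in> W" for z
      using that by (auto simp: chart_at_infinity_def image_iff intro!: bexI[of _ "inverse z"])
    then show ?thesis using False by (auto simp: chart_at_infinity_def)
  qed
  then show ?thesis using open_inverse_vimage[OF assms] by simp
qed

lemma open_vimage_sphere_param:
  assumes "\<sigma> \<in> sphere_params" "openin sphere_topology V"
  shows "open (\<sigma> -` V)"
proof -
  have "open (Some -` V)"
    using openin_continuous_map_preimage[OF continuous_map_Some assms(2)]
    by (simp add: vimage_def)
  then show ?thesis using assms open_vimage_chart_at_infinity by (auto simp: sphere_params_eq)
qed

lemma openin_sphere_param_image:
  assumes "\<sigma> \<in> sphere_params" "open W"
  shows "openin sphere_topology (\<sigma> ` W)"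
  using assms openin_chart_at_infinity_image by (auto simp: sphere_params_eq)

lemma ex_sphere_param: "\<exists>\<sigma>\<in>sphere_params. p \<in> range \<sigma>"
  by (cases p) (auto simp: sphere_params_eq range_chart_at_infinity)

section \<open>Criteria for holomorphy on the sphere\<close>

lemma sphere_holomorphic_onI:
  assumes U: "openin sphere_topology U"
    and "\<And>\<sigma> \<tau>. \<sigma> \<in> sphere_params \<Longrightarrow> \<tau> \<in> sphere_params \<Longrightarrow>
      open {z. \<sigma> z \<in> U \<and> f (\<sigma> z) \<in> range \<tau>} \<and>
      (\<lambda>z. inv \<tau> (f (\<sigma> z))) holomorphic_on {z. \<sigma> z \<in> U \<and> f (\<sigma> z) \<in> range \<tau>}"
  shows "sphere_holomorphic_on f U"
proof -
  define S where "S \<sigma> \<tau> = {z. \<sigma> z \<in> U \<and> f (\<sigma> z) \<in> range \<tau>}" for \<sigma> \<tau> :: "complex \<Rightarrow> sphere"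
  have S: "open (S \<sigma> \<tau>)" "(\<lambda>z. inv \<tau> (f (\<sigma> z))) holomorphic_on S \<sigma> \<tau>"
    if "\<sigma> \<in> sphere_params" "\<tau> \<in> sphere_params" for \<sigma> \<tau>
    using assms(2)[OF that] by (simp_all add: S_def)
  \<comment> \<open>Continuity comes from the charts: the coordinate expressions are holomorphic,
    hence continuous, on open sets, so the preimage of \<open>V\<close> is a union of chart images
    of open sets.\<close>
  have "openin sphere_topology {p \<in> U. f p \<in> V}" if V: "openin sphere_topology V" for V
  proof -
    define A where "A \<sigma> \<tau> = S \<sigma> \<tau> \<inter> (\<lambda>z. inv \<tau> (f (\<sigma> z))) -` (\<tau> -` V)" for \<sigma> \<tau>
    have "open (A \<sigma> \<tau>)" if "\<sigma> \<in> sphere_params" "\<tau> \<in> sphere_params" for \<sigma> \<tau>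
      unfolding A_def using S[OF that] open_vimage_sphere_param[OF that(2) V]
      by (intro continuous_open_preimage holomorphic_on_imp_continuous_on)
    then have "openin sphere_topology (\<Union>\<sigma>\<in>sphere_params. \<Union>\<tau>\<in>sphere_params. \<sigma> ` A \<sigma> \<tau>)"
      by (intro openin_Union ballI) (auto intro: openin_sphere_param_image)
    also have "(\<Union>\<sigma>\<in>sphere_params. \<Union>\<tau>\<in>sphere_params. \<sigma> ` A \<sigma> \<tau>) = {p \<in> U. f p \<in> V}"
    proof (intro equalityI subsetI)
      fix p assume "p \<in> (\<Union>\<sigma>\<in>sphere_params. \<Union>\<tau>\<in>sphere_params. \<sigma> ` A \<sigma> \<tau>)"
      then show "p \<in> {p \<in> U. f p \<in> V}" by (auto simp: A_def S_def f_inv_into_f)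
    next
      fix p assume p: "p \<in> {p \<in> U. f p \<in> V}"
      obtain \<sigma> z where \<sigma>: "\<sigma> \<in> sphere_params" "p = \<sigma> z" using ex_sphere_param[of p] by auto
      obtain \<tau> where \<tau>: "\<tau> \<in> sphere_params" "f p \<in> range \<tau>" using ex_sphere_param[of "f p"] by auto
      have "z \<in> A \<sigma> \<tau>" using p \<sigma> \<tau> by (simp add: A_def S_def f_inv_into_f)
      then show "p \<in> (\<Union>\<sigma>\<in>sphere_params. \<Union>\<tau>\<in>sphere_params. \<sigma> ` A \<sigma> \<tau>)"
        using \<sigma> \<tau> by blast
    qed
    finally show ?thesis .
  qed
  then have "continuous_map (subtopology sphere_topology U) sphere_topology f"
    using U openin_subset[OF U]
    by (auto simp: continuous_map openin_open_subtopology image_subset_iff UNIV_option_conv[symmetric]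
         Int_absorb1)
  then show ?thesis using U S by (simp add: sphere_holomorphic_on_def S_def)
qed

text \<open>Without common zeros of \<open>a\<close> and \<open>d\<close>, a pole is harmless: in
  the target coordinate at infinity the map reads \<open>d / a\<close>.\<close>

lemma sphere_holomorphic_on_quotient:
  assumes D: "open D" and a: "a holomorphic_on D" and d: "d holomorphic_on D"
    and nz: "\<And>z. z \<in> D \<Longrightarrow> a z \<noteq> 0 \<or> d z \<noteq> 0"
    and f: "\<And>z. z \<in> D \<Longrightarrow> f (Some z) = (if d z = 0 then None else Some (a z / d z))"
  shows "sphere_holomorphic_on f (Some ` D)"
proof (rule sphere_holomorphic_onI)
  show "openin sphere_topology (Some ` D)" using D by simp
next
  fix \<sigma> \<tau> assume \<sigma>: "\<sigma> \<in> sphere_params" and \<tau>: "\<tau> \<in> sphere_params"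
  define E where "E = {z \<in> D. f (Some z) \<in> range \<tau>}"
  define G where "G z = inv \<tau> (f (Some z))" for z
  have preimage: "open {z \<in> D. h z \<noteq> 0}" if "h holomorphic_on D" for h :: "complex \<Rightarrow> complex"
    using continuous_open_preimage[OF holomorphic_on_imp_continuous_on[OF that] D, of "-{0}"]
    by (simp add: open_Compl vimage_def Int_def)
  have "open E \<and> G holomorphic_on E"
  proof (cases "\<tau> = Some")
    case True
    have E: "E = {z \<in> D. d z \<noteq> 0}" using f by (auto simp: E_def True)
    have "(\<lambda>z. a z / d z) holomorphic_on E"
      using a d by (intro holomorphic_intros) (auto simp: E intro: holomorphic_on_subset)
    moreover have "a z / d z = G z" if "z \<in> E" for z using that f by (simp add: G_def E True)
    ultimately have "G holomorphic_on E" by (rule holomorphic_transform)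
    then show ?thesis using preimage[OF d] by (simp add: E)
  next
    case False
    then have \<tau>_inf: "\<tau> = chart_at_infinity" using \<tau> by (simp add: sphere_params_eq)
    \<comment> \<open>By \<open>nz\<close> the numerator does not vanish at a pole, so the value
      differs from \<open>Some 0\<close> exactly where \<open>a z \<noteq> 0\<close>; at a pole
      \<open>d z / a z = 0\<close> is the coordinate of infinity.\<close>
    have E: "E = {z \<in> D. a z \<noteq> 0}"
      using f nz by (auto simp: E_def \<tau>_inf range_chart_at_infinity split: if_splits)
    have "(\<lambda>z. d z / a z) holomorphic_on E"
      using a d by (intro holomorphic_intros) (auto simp: E intro: holomorphic_on_subset)
    moreover have "d z / a z = G z" if "z \<in> E" for z
      using that f by (simp add: G_def E \<tau>_inf)
    ultimately have "G holomorphic_on E" by (rule holomorphic_transform)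
    then show ?thesis using preimage[OF a] by (simp add: E)
  qed
  then have E: "open E" and G: "G holomorphic_on E" by auto
  show "open {z. \<sigma> z \<in> Some ` D \<and> f (\<sigma> z) \<in> range \<tau>} \<and>
     (\<lambda>z. inv \<tau> (f (\<sigma> z))) holomorphic_on {z. \<sigma> z \<in> Some ` D \<and> f (\<sigma> z) \<in> range \<tau>}"
  proof (cases "\<sigma> = Some")
    case True
    have "{z. \<sigma> z \<in> Some ` D \<and> f (\<sigma> z) \<in> range \<tau>} = E" by (auto simp: E_def True)
    then show ?thesis using E G by (simp add: True G_def[abs_def])
  next
    case False
    then have \<sigma>_inf: "\<sigma> = chart_at_infinity" using \<sigma> by (simp add: sphere_params_eq)
    \<comment> \<open>The domain omits infinity, so the coordinate \<open>0\<close> drops out and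
      the chart change is plain inversion.\<close>
    have S: "{z. \<sigma> z \<in> Some ` D \<and> f (\<sigma> z) \<in> range \<tau>} = {w. w \<noteq> 0 \<and> inverse w \<in> E}" (is "?S = _")
      by (auto simp: E_def \<sigma>_inf chart_at_infinity_def split: if_splits)
    have "G \<circ> inverse holomorphic_on ?S"
      unfolding S by (intro holomorphic_on_compose_gen[OF _ G] holomorphic_intros) auto
    moreover have "(G \<circ> inverse) w = inv \<tau> (f (\<sigma> w))" if "w \<in> ?S" for w
      using that unfolding S by (simp add: G_def \<sigma>_inf chart_at_infinity_def)
    ultimately have "(\<lambda>z. inv \<tau> (f (\<sigma> z))) holomorphic_on ?S" by (rule holomorphic_transform)
    then show ?thesis using open_inverse_vimage[OF E] unfolding S by blast
  qed
qed

text \<open>In the four pairs of charts the map reads \<open>\<omega> * z\<close>,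
  \<open>inverse (\<omega> * z)\<close>, \<open>\<omega> * inverse z\<close> and
  \<open>inverse \<omega> * z\<close>; the last one treats infinity as the ordinary point
  \<open>0\<close>.\<close>

lemma sphere_holomorphic_on_rotation:
  assumes "\<omega> \<noteq> 0"
  shows "sphere_holomorphic_on (rotation \<omega>) UNIV"
proof (rule sphere_holomorphic_onI)
  show "openin sphere_topology UNIV"
    using openin_topspace[of sphere_topology] by (simp add: UNIV_option_conv[symmetric])
next
  have S: "Collect ((\<noteq>) 0) = {w. w \<noteq> (0::complex)}" "open {w. w \<noteq> (0::complex)}"
    using open_delete[OF open_UNIV, of "0::complex"] by (auto simp: Compl_eq_Diff_UNIV[symmetric] Collect_neg_eq)
  have cong: "open A \<and> h holomorphic_on A"
    if "A = B" "open B" "k holomorphic_on B" "\<And>z. z \<in> B \<Longrightarrow> h z = k z"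
    for A B and h k :: "complex \<Rightarrow> complex"
    using that holomorphic_transform[OF that(3), of h] by simp
  fix \<sigma> \<tau> assume "\<sigma> \<in> sphere_params" "\<tau> \<in> sphere_params"
  then consider "\<sigma> = Some" "\<tau> = Some" | "\<sigma> = Some" "\<tau> = chart_at_infinity"
    | "\<sigma> = chart_at_infinity" "\<tau> = Some" | "\<sigma> = chart_at_infinity" "\<tau> = chart_at_infinity"
    by (auto simp: sphere_params_eq)
  then show "open {z. \<sigma> z \<in> UNIV \<and> rotation \<omega> (\<sigma> z) \<in> range \<tau>} \<and>
     (\<lambda>z. inv \<tau> (rotation \<omega> (\<sigma> z))) holomorphic_on {z. \<sigma> z \<in> UNIV \<and> rotation \<omega> (\<sigma> z) \<in> range \<tau>}"
  proof cases
    case 1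
    show ?thesis
      by (rule cong[where B = UNIV and k = "\<lambda>z. \<omega> * z"])
        (auto simp: 1 rotation_def intro!: holomorphic_intros)
  next
    case 2
    show ?thesis
      by (rule cong[where B = "{w. w \<noteq> 0}" and k = "\<lambda>z. inverse (\<omega> * z)"])
        (use assms S in \<open>auto simp: 2 rotation_def range_chart_at_infinity intro!: holomorphic_intros\<close>)
  next
    case 3
    show ?thesis
      by (rule cong[where B = "{w. w \<noteq> 0}" and k = "\<lambda>z. \<omega> * inverse z"])
        (use assms S in \<open>auto simp: 3 rotation_def chart_at_infinity_def intro!: holomorphic_intros split: if_splits\<close>)
  next
    case 4
    show ?thesis
      unfolding 4 range_chart_at_infinity
      by (rule cong[where B = UNIV and k = "\<lambda>z. inverse \<omega> * z"])
        (use assms in \<open>auto simp: rotation_def chart_at_infinity_def intro!: holomorphic_intros\<close>)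
  qed
qed

section \<open>The disc involution\<close>

text \<open>For \<open>0 < \<rho> < 1\<close> this is the normalized Blaschke factor with zero
  \<open>\<rho>\<close>: the disc automorphism exchanging \<open>0\<close> and
  \<open>\<rho>\<close>, extended to the sphere.\<close>

definition disc_involution :: "real \<Rightarrow> sphere \<Rightarrow> sphere" where
  "disc_involution \<rho> p =
     (case p of
        None \<Rightarrow> Some (1 / of_real \<rho>)
      | Some u \<Rightarrow> if of_real \<rho> * u = 1 then None
                 else Some ((u - of_real \<rho>) / (of_real \<rho> * u - 1)))"

lemma disc_involution_involution:
  assumes "0 < \<rho>" "\<rho> < 1"
  shows "disc_involution \<rho> (disc_involution \<rho> p) = p"
proof (cases p)
  case None
  then show ?thesis using assms by (simp add: disc_involution_def)
next
  case (Some u)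
  \<comment> \<open>The determinant of the Moebius map is \<open>\<rho> * \<rho> - 1\<close>, so
    this is its nondegeneracy.\<close>
  have \<rho>: "of_real \<rho> * of_real \<rho> \<noteq> (1::complex)"
    using assms by (metis mult_strict_mono' less_eq_real_def mult_1 less_irrefl of_real_eq_1_iff of_real_mult)
  show ?thesis
  proof (cases "of_real \<rho> * u = 1")
    case True
    then show ?thesis using Some assms by (simp add: disc_involution_def field_simps)
  next
    case False
    then have d: "of_real \<rho> * u - 1 \<noteq> 0" by simp
    define v where "v = (u - of_real \<rho>) / (of_real \<rho> * u - 1)"
    \<comment> \<open>\<open>\<rho> * v - 1\<close> and \<open>v - \<rho>\<close> share the factor
      \<open>(1 - \<rho> * \<rho>) / (\<rho> * u - 1)\<close>, which cancels in the second
      application and leaves \<open>u\<close>.\<close>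
    have 1: "of_real \<rho> * v - 1 = (1 - of_real \<rho> * of_real \<rho>) / (of_real \<rho> * u - 1)"
      using d unfolding v_def by (simp add: divide_simps) (simp add: algebra_simps)
    have 2: "v - of_real \<rho> = u * (1 - of_real \<rho> * of_real \<rho>) / (of_real \<rho> * u - 1)"
      using d unfolding v_def by (simp add: divide_simps) (simp add: algebra_simps)
    have nz: "of_real \<rho> * v - 1 \<noteq> 0" unfolding 1 using \<rho> d by simp
    have "(v - of_real \<rho>) / (of_real \<rho> * v - 1) = u"
      unfolding 1 2 using \<rho> d by (simp add: divide_simps)
    then show ?thesis using Some False nz by (simp add: disc_involution_def v_def)
  qed
qed

lemma bij_disc_involution: "0 < \<rho> \<Longrightarrow> \<rho> < 1 \<Longrightarrow> bij (disc_involution \<rho>)"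
  by (rule involuntory_imp_bij) (rule disc_involution_involution)

text \<open>A bijection commutes with complements, so it suffices to follow the arc from
  \<open>0\<close> to infinity along the negative reals.\<close>

lemma disc_involution_image_slit_plane:
  assumes "0 < \<rho>" "\<rho> < 1"
  shows "disc_involution \<rho> ` Some ` (- \<real>\<^sub>\<le>\<^sub>0) = UNIV - (\<lambda>x. Some (complex_of_real x)) ` {\<rho>..1 / \<rho>}"
proof -
  note inj = bij_is_inj[OF bij_disc_involution[OF assms]]
  have "disc_involution \<rho> ` insert None (Some ` \<real>\<^sub>\<le>\<^sub>0) = (\<lambda>x. Some (complex_of_real x)) ` {\<rho>..1 / \<rho>}" (is "_ = ?L")
  proof (intro equalityI subsetI)
    fix q assume "q \<in> disc_involution \<rho> ` insert None (Some ` \<real>\<^sub>\<le>\<^sub>0)"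
    then consider "q = disc_involution \<rho> None" | x where "x \<le> 0" "q = disc_involution \<rho> (Some (of_real x))"
      by (auto elim!: nonpos_Reals_cases)
    then show "q \<in> ?L"
    proof cases
      case 1
      have "\<rho> \<le> 1 / \<rho>" using assms by (simp add: field_simps mult_le_one)
      then show ?thesis using 1 by (auto simp: disc_involution_def image_iff intro!: bexI[of _ "1 / \<rho>"])
    next
      case 2
      have d: "\<rho> * x - 1 < 0" using assms(1) 2(1) by (smt (verit) mult_nonneg_nonpos)
      then have "of_real \<rho> * of_real x \<noteq> (1::complex)"
        by (metis diff_self less_irrefl of_real_eq_1_iff of_real_mult)
      then have q: "q = Some (of_real ((x - \<rho>) / (\<rho> * x - 1)))" using 2(2) by (simp add: disc_involution_def)
      \<comment> \<open>As \<open>\<rho> * x - 1 < 0\<close>, clearing denominators reverses the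
        inequalities: the lower bound becomes \<open>x \<le> \<rho> * \<rho> * x\<close>, the upper
        bound \<open>\<rho> \<le> 1 / \<rho>\<close>.\<close>
      have "\<rho> * \<rho> \<le> 1" using assms by (simp add: mult_le_one)
      then have "\<rho> \<le> 1 / \<rho>" "1 * x \<le> \<rho> * \<rho> * x"
        using assms 2(1) by (simp add: pos_le_divide_eq, intro mult_right_mono_neg)
      then have "\<rho> \<le> (x - \<rho>) / (\<rho> * x - 1)" "(x - \<rho>) / (\<rho> * x - 1) \<le> 1 / \<rho>"
        using d assms(1) by (simp_all add: neg_le_divide_eq neg_divide_le_eq right_diff_distrib mult.assoc)
      then show ?thesis unfolding q by (intro image_eqI[OF refl]) simp
    qed
  next
    fix q assume "q \<in> ?L"
    then obtain x where x: "\<rho> \<le> x" "x \<le> 1 / \<rho>" "q = Some (of_real x)" by auto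
    \<comment> \<open>The map is its own inverse, so it sends \<open>q\<close> to its only preimage;
      the endpoint \<open>1 / \<rho>\<close> comes from infinity.\<close>
    have "disc_involution \<rho> q \<in> insert None (Some ` \<real>\<^sub>\<le>\<^sub>0)"
    proof (cases "\<rho> * x = 1")
      case True
      then have "of_real \<rho> * of_real x = (1::complex)" by (metis of_real_1 of_real_mult)
      then show ?thesis using x by (simp add: disc_involution_def)
    next
      case False
      then have "\<rho> * x - 1 < 0" using x assms by (simp add: field_simps)
      moreover have "of_real \<rho> * of_real x \<noteq> (1::complex)"
        using False by (metis of_real_eq_1_iff of_real_mult)
      then have "disc_involution \<rho> q = Some (of_real ((x - \<rho>) / (\<rho> * x - 1)))"
        using x by (simp add: disc_involution_def)
      moreover have "(x - \<rho>) / (\<rho> * x - 1) \<le> 0"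
        using x(1) calculation(1) by (simp add: divide_nonneg_neg)
      then have "complex_of_real ((x - \<rho>) / (\<rho> * x - 1)) \<in> \<real>\<^sub>\<le>\<^sub>0"
        by (simp only: nonpos_Reals_of_real_iff)
      ultimately show ?thesis by blast
    qed
    then show "q \<in> disc_involution \<rho> ` insert None (Some ` \<real>\<^sub>\<le>\<^sub>0)"
      by (metis disc_involution_involution[OF assms] imageI)
  qed
  moreover have "Some ` (- \<real>\<^sub>\<le>\<^sub>0) = (UNIV :: sphere set) - insert None (Some ` \<real>\<^sub>\<le>\<^sub>0)"
    by (auto simp: UNIV_option_conv)
  ultimately show ?thesis
    by (simp only: image_set_diff[OF inj] bij_is_surj[OF bij_disc_involution[OF assms]])
qed

text \<open>A continuous injection of a compact space into a Hausdorff space is an embedding; the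
  sphere is Hausdorff because the plane is Hausdorff and locally compact.\<close>

lemma slit_real_interval:
  assumes "a < b"
  shows "slit ((\<lambda>x. Some (complex_of_real x)) ` {a..b})"
proof -
  have "continuous_map (top_of_set {a..b}) euclidean complex_of_real"
    by (simp add: continuous_on_of_real)
  then have "continuous_map (top_of_set {a..b}) sphere_topology (Some \<circ> complex_of_real)"
    by (rule continuous_map_compose) (rule continuous_map_Some)
  moreover have "Hausdorff_space sphere_topology"
    by (simp add: Hausdorff_space_Alexandroff_compactification locally_compact_space_euclidean)
  ultimately have "embedding_map (top_of_set {a..b}) sphere_topology (Some \<circ> complex_of_real)"
    by (intro continuous_imp_embedding_map) (auto simp: inj_on_def compact_space_subtopology)
  then have "top_of_set {a..b} homeomorphic_space
      subtopology sphere_topology ((Some \<circ> complex_of_real) ` {a..b})"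
    using embedding_map_imp_homeomorphic_space by fastforce
  moreover have "top_of_set {0..1::real} homeomorphic_space top_of_set {a..b}"
  proof -
    obtain f g where "homeomorphism {0..1::real} {a..b} f g"
      using homeomorphic_closed_intervals_real[of 0 1 a b] assms by (auto simp: homeomorphic_def)
    then have "homeomorphic_maps (top_of_set {0..1::real}) (top_of_set {a..b}) f g"
      by (auto simp: homeomorphic_maps_def homeomorphism_def)
    then show ?thesis by (auto simp: homeomorphic_space_def)
  qed
  ultimately show ?thesis
    unfolding slit_def comp_def by (meson homeomorphic_space_sym homeomorphic_space_trans)
qed

section \<open>Sectors and covering transformations\<close>

lemma roots_of_unity_eq: "n \<ge> 1 \<Longrightarrow> {w. w ^ n = 1} = unity_root n ` {..<n}"
  using Complex.bij_betw_roots_unity[of n]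
  by (simp add: bij_betw_def unity_root_cis[abs_def])

text \<open>The outer phase cancels the phase in the numerator, so \<open>z\<close> enters only
  through the power map, to which both the sectors and the covering transformations are then
  reduced.\<close>

lemma blaschke_eq_disc_involution:
  "blaschke n r \<alpha> (Some z) =
     disc_involution (r ^ n) (Some (exp (- (\<i> * of_nat n * of_real \<alpha>)) * z ^ n))"
proof -
  define e where "e = exp (- (\<i> * of_nat n * of_real \<alpha>))"
  have "e * exp (\<i> * of_nat n * of_real \<alpha>) = 1"
    unfolding e_def by (simp add: exp_minus)
  then have "e * (z ^ n - of_real r ^ n * exp (\<i> * of_nat n * of_real \<alpha>)) = e * z ^ n - of_real r ^ n"
    by (simp add: algebra_simps)
  then show ?thesis
    unfolding blaschke_def disc_involution_def e_def[symmetric]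
    by (simp add: Let_def mult_ac)
qed

section \<open>The rays and the sectors between them\<close>

lemma Union_rays_eq:
  assumes "n \<ge> 1"
  shows "(\<Union>k<n. ray n \<alpha> k) = {z. exp (- (\<i> * of_nat n * of_real \<alpha>)) * z ^ n \<in> \<real>\<^sub>\<le>\<^sub>0}"
proof -
  define e where "e = exp (- (\<i> * of_nat n * of_real \<alpha>))"
  \<comment> \<open>\<open>c\<close> is the unit direction of ray \<open>0\<close>; the other rays
    are its rotations by \<open>unity_root n k\<close>. The identity \<open>e * c ^ n = -1\<close>
    below places them all over the nonpositive reals.\<close>
  define c where "c = exp (\<i> * of_real (\<alpha> + pi / n))"
  have n: "of_nat n \<noteq> (0::complex)" using assms by simp
  have "of_nat n * (\<i> * of_real (\<alpha> + pi / n)) = \<i> * of_nat n * of_real \<alpha> + \<i> * of_real pi"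
    using n by (simp add: field_simps)
  then have "c ^ n = exp (\<i> * of_nat n * of_real \<alpha>) * exp (\<i> * of_real pi)"
    unfolding c_def exp_of_nat_mult[symmetric] exp_add[symmetric] by simp
  then have ec: "e * c ^ n = -1" by (simp add: e_def exp_minus)
  have ray: "z \<in> ray n \<alpha> k \<longleftrightarrow> (\<exists>t\<ge>0. z = c * unity_root n k * of_real t)" for z k
  proof -
    have "exp (\<i> * of_real (\<alpha> + (2 * real k + 1) * pi / real n)) = c * unity_root n k"
      unfolding c_def unity_root_def exp_add[symmetric] by (simp add: add_divide_distrib algebra_simps)
    then show ?thesis unfolding ray_def by simp blast
  qed
  have "e * z ^ n \<in> \<real>\<^sub>\<le>\<^sub>0" if z: "z \<in> ray n \<alpha> k" and k: "k < n" for z k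
  proof -
    obtain t where t: "t \<ge> 0" "z = c * unity_root n k * of_real t" using z ray by blast
    have "unity_root n k ^ n = 1" using roots_of_unity_eq[OF assms] k by blast
    then have "e * z ^ n = of_real (- (t ^ n))"
      using ec t by (simp add: power_mult_distrib mult.assoc[symmetric])
    moreover have "complex_of_real (- (t ^ n)) \<in> \<real>\<^sub>\<le>\<^sub>0"
      using t(1) by (simp only: nonpos_Reals_of_real_iff) simp
    ultimately show ?thesis by simp
  qed
  moreover have "\<exists>k<n. z \<in> ray n \<alpha> k" if z: "e * z ^ n \<in> \<real>\<^sub>\<le>\<^sub>0" for z
  \<comment> \<open>The origin lies on every ray; it is set aside because the other case divides by
    \<open>norm z\<close>.\<close>
  proof (cases "z = 0")
    case True
    then show ?thesis using assms by (auto simp: ray intro!: exI[of _ 0])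
  next
    case False
    obtain s where s: "s \<le> 0" "e * z ^ n = of_real s" using z by (auto elim: nonpos_Reals_cases)
    \<comment> \<open>Since \<open>e\<close> has modulus \<open>1\<close>, norms determine
      \<open>s\<close>; then \<open>z\<close> and \<open>c * of_real (norm z)\<close> have equal
      \<open>n\<close>-th powers and differ by a root of unity.\<close>
    have "norm (e * z ^ n) = norm z ^ n" by (simp add: e_def norm_mult norm_power)
    then have "s = - (norm z ^ n)" using s by simp
    then have "e * z ^ n = - of_real (norm z ^ n)" using s(2) by simp
    also have "\<dots> = e * (c * of_real (norm z)) ^ n"
      using ec by (simp add: power_mult_distrib mult.assoc[symmetric])
    finally have "z ^ n = (c * of_real (norm z)) ^ n" by (simp add: e_def)
    moreover have nz: "c * of_real (norm z) \<noteq> 0" using False by (simp add: c_def)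
    ultimately have "(z / (c * of_real (norm z))) ^ n = 1" by (simp add: power_divide False c_def)
    then obtain k where k: "k < n" "z / (c * of_real (norm z)) = unity_root n k"
      using roots_of_unity_eq[OF assms] by blast
    then have "z = c * unity_root n k * of_real (norm z)" using nz by (simp add: field_simps)
    then show ?thesis using k(1) by (auto simp: ray intro!: exI[of _ "norm z"] exI[of _ k])
  qed
  ultimately show ?thesis unfolding e_def[symmetric] by blast
qed

text \<open>Each \<open>n\<close>-th root of unity \<open>w\<close> gives a section
  \<open>\<lambda>u. w * g u\<close> of the power map over the slit plane, and a component is the
  image of one such section.\<close>

lemma component_power_slit_plane:
  fixes e :: complex
  assumes "n \<ge> 1" "e \<noteq> 0"
    and D: "D \<in> components {z. e * z ^ n \<notin> \<real>\<^sub>\<le>\<^sub>0}"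
  shows "bij_betw (\<lambda>z. e * z ^ n) D (- \<real>\<^sub>\<le>\<^sub>0)"
proof -
  define A where "A = {z. e * z ^ n \<notin> \<real>\<^sub>\<le>\<^sub>0}"
  \<comment> \<open>A branch of the \<open>n\<close>-th root of \<open>u / e\<close>. Splitting the
    logarithm keeps \<open>Ln e\<close> constant, so \<open>g\<close> is continuous wherever
    \<open>Ln u\<close> is, off the nonpositive reals.\<close>
  define g where "g u = exp ((Ln u - Ln e) / of_nat n)" for u
  have g_pow: "e * g u ^ n = u" if "u \<noteq> 0" for u
  proof -
    have "g u ^ n = exp (Ln u - Ln e)"
      unfolding g_def exp_of_nat_mult[symmetric] using assms(1) by simp
    then show ?thesis using that assms(2) by (simp add: exp_diff)
  qed
  have gnz: "g u \<noteq> 0" for u by (simp add: g_def)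
  have DA: "D \<subseteq> A" and conn: "connected D" and ne: "D \<noteq> {}"
    using in_components_subset[OF D] in_components_connected[OF D] in_components_nonempty[OF D]
    by (auto simp: A_def)
  define h where "h z = z / g (e * z ^ n)" for z
  have h_pow: "h z ^ n = 1" if "z \<in> A" for z
  proof -
    have nz: "e * z ^ n \<noteq> 0" using that unfolding A_def by force
    then have "z \<noteq> 0" using assms(1) by (intro notI) simp
    from g_pow[OF nz] have "g (e * z ^ n) ^ n = z ^ n" using assms(2) by simp
    then show ?thesis using \<open>z \<noteq> 0\<close> by (simp add: h_def power_divide)
  qed
  have "h constant_on D"
  proof (rule continuous_finite_range_constant[OF conn])
    show "continuous_on D h"
      unfolding h_def g_def using DA assms(1) by (intro continuous_intros) (auto simp: A_def)
    have "h ` D \<subseteq> {w. w ^ n = 1}" using h_pow DA by auto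
    moreover have "finite {w::complex. w ^ n = 1}" by (simp add: roots_of_unity_eq[OF assms(1)])
    ultimately show "finite (h ` D)" by (rule finite_subset)
  qed
  then obtain w where w: "\<And>z. z \<in> D \<Longrightarrow> h z = w" by (auto simp: constant_on_def)
  then have wn: "w ^ n = 1" using ne h_pow DA by blast
  have D_eq: "z = w * g (e * z ^ n)" if "z \<in> D" for z
    using w[OF that] gnz[of "e * z ^ n"] by (simp add: h_def field_simps)
  have pow: "e * (w * g u) ^ n = u" if "u \<notin> \<real>\<^sub>\<le>\<^sub>0" for u
  proof -
    have "u \<noteq> 0" using that by auto
    then show ?thesis using g_pow[of u] wn by (simp add: power_mult_distrib)
  qed
  \<comment> \<open>For surjectivity: the image of the section is connected, stays in
    \<open>A\<close> and meets \<open>D\<close>, so maximality of the component puts it inside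
    \<open>D\<close>.\<close>
  have "connected ((\<lambda>u. w * g u) ` (- \<real>\<^sub>\<le>\<^sub>0))"
  proof (intro connected_continuous_image)
    show "continuous_on (- \<real>\<^sub>\<le>\<^sub>0) (\<lambda>u. w * g u)"
      unfolding g_def using assms(1) by (intro continuous_intros) auto
    show "connected (- \<real>\<^sub>\<le>\<^sub>0 :: complex set)"
    proof -
      have "\<real>\<^sub>\<le>\<^sub>0 = complex_of_real ` {..0}" by (auto elim!: nonpos_Reals_cases)
      then show ?thesis
        using starlike_imp_connected[OF starlike_slotted_complex_plane_left[of 0]] by simp
    qed
  qed
  moreover obtain z where "z \<in> D" using ne by auto
  then have "z \<in> D \<inter> (\<lambda>u. w * g u) ` (- \<real>\<^sub>\<le>\<^sub>0)"
    using D_eq DA by (auto simp: A_def image_iff)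
  moreover have "(\<lambda>u. w * g u) ` (- \<real>\<^sub>\<le>\<^sub>0) \<subseteq> A" using pow by (auto simp: A_def)
  ultimately have "(\<lambda>u. w * g u) ` (- \<real>\<^sub>\<le>\<^sub>0) \<subseteq> D"
    using components_maximal[OF D[folded A_def]] by blast
  then show ?thesis
    using DA D_eq pow by (intro bij_betw_byWitness[where f' = "\<lambda>u. w * g u"]) (auto simp: A_def)
qed

section \<open>Covering transformations\<close>

lemma continuous_on_punctured_planeI:
  assumes T: "continuous_map sphere_topology sphere_topology T"
    and f: "\<And>z. z \<noteq> 0 \<Longrightarrow> T (Some z) = Some (f z)"
  shows "continuous_on (- {0}) f"
proof (rule continuous_on_open_vimage[THEN iffD2, rule_format])
  show "open (- {0::complex})" by (simp add: open_Compl)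
next
  fix V :: "complex set" assume "open V"
  \<comment> \<open>\<open>Some\<close> embeds the plane as an open subset, so the copy of
    \<open>V\<close> is open in the sphere and can be pulled back along
    \<open>T \<circ> Some\<close>.\<close>
  have "continuous_map euclidean sphere_topology (T \<circ> Some)"
    by (rule continuous_map_compose[OF continuous_map_Some T])
  then have "open {z. T (Some z) \<in> Some ` V}"
    using openin_continuous_map_preimage[of euclidean sphere_topology "T \<circ> Some" "Some ` V"] \<open>open V\<close>
    by simp
  then have "open ({z. T (Some z) \<in> Some ` V} \<inter> - {0})" by (intro open_Int) auto
  also have "{z. T (Some z) \<in> Some ` V} \<inter> - {0} = f -` V \<inter> - {0}" using f by auto
  finally show "open (f -` V \<inter> - {0})" .
qed

text \<open>The disc involution is injective, so invariance of the Blaschke product under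
  \<open>T\<close> means that \<open>T\<close> maps every fibre of the power map \<open>P\<close>
  into itself.\<close>

lemma covering_transformations_blaschke:
  assumes "n \<ge> 1" "0 < r" "r < 1"
  shows "covering_transformations (blaschke n r \<alpha>) = (\<lambda>j. rotation (unity_root n j)) ` {..<n}"
proof -
  define e where "e = exp (- (\<i> * of_nat n * of_real \<alpha>))"
  have enz: "e \<noteq> 0" by (simp add: e_def)
  define P where "P = map_option (\<lambda>z. e * z ^ n)"
  have \<rho>: "0 < r ^ n" "r ^ n < 1" using assms by (simp_all add: power_Suc_less_one power_less_one_iff)
  have B: "blaschke n r \<alpha> p = disc_involution (r ^ n) (P p)" for p
    by (cases p) (simp_all add: blaschke_eq_disc_involution e_def P_def,
        simp add: blaschke_def disc_involution_def)
  have fibre: "blaschke n r \<alpha> p = blaschke n r \<alpha> q \<longleftrightarrow> P p = P q" for p q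
    using bij_is_inj[OF bij_disc_involution[OF \<rho>]] by (simp add: B inj_eq)
  show ?thesis
  proof (intro equalityI subsetI)
    fix T assume "T \<in> covering_transformations (blaschke n r \<alpha>)"
    then have BT: "\<And>p. blaschke n r \<alpha> (T p) = blaschke n r \<alpha> p"
      and cont: "continuous_map sphere_topology sphere_topology T"
      by (auto simp: covering_transformations_def fun_eq_iff conformal_on_def sphere_holomorphic_on_def)
    then have PT: "P (T p) = P p" for p using fibre BT by blast
    define f where "f z = the (T (Some z))" for z
    \<comment> \<open>\<open>P\<close> takes the value infinity only at infinity, so
      \<open>T\<close> fixes infinity and restricts to a self-map \<open>f\<close> of the
      plane.\<close>
    have None: "T None = None" using PT[of None] by (simp add: P_def)
    have f: "T (Some z) = Some (f z)" "f z ^ n = z ^ n" for z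
      using PT[of "Some z"] enz by (auto simp: P_def f_def)
    define h where "h z = f z / z" for z
    have h_pow: "h z ^ n = 1" if "z \<noteq> 0" for z using f(2)[of z] that by (simp add: h_def power_divide)
    have "h constant_on (- {0})"
    proof (rule continuous_finite_range_constant)
      show "connected (- {0::complex})" by (simp add: connected_punctured_universe)
      show "continuous_on (- {0}) h"
        unfolding h_def by (intro continuous_intros continuous_on_punctured_planeI[OF cont] f) auto
      have "h ` (- {0}) \<subseteq> {w. w ^ n = 1}" using h_pow by auto
      moreover have "finite {w::complex. w ^ n = 1}" by (simp add: roots_of_unity_eq[OF assms(1)])
    ultimately show "finite (h ` (- {0}))" by (rule finite_subset)
    qed
    then obtain w where w: "\<And>z. z \<noteq> 0 \<Longrightarrow> h z = w" by (auto simp: constant_on_def)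
    then have "w ^ n = 1" using h_pow[of 1] by force
    then obtain j where j: "j < n" "w = unity_root n j" using roots_of_unity_eq[OF assms(1)] by blast
    \<comment> \<open>The quotient \<open>h\<close> carries no information at the origin; there
      \<open>f 0 ^ n = 0\<close> determines the value.\<close>
    have "f 0 = 0" using f(2)[of 0] assms(1) by (cases n) auto
    then have "f z = w * z" for z using w[of z] by (cases "z = 0") (auto simp: h_def field_simps)
    then have "T = rotation w" using None f(1)
      by (intro ext) (metis (no_types) rotation_def not_None_eq option.simps(8,9))
    then show "T \<in> (\<lambda>j. rotation (unity_root n j)) ` {..<n}" using j by auto
  next
    fix T assume "T \<in> (\<lambda>j. rotation (unity_root n j)) ` {..<n}"
    then obtain w where T: "T = rotation w" and w: "w ^ n = 1"
      using roots_of_unity_eq[OF assms(1)] by auto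
    have wnz: "w \<noteq> 0" using w assms(1) by (auto simp: power_0_left)
    have "rotation w (rotation (inverse w) p) = p" "rotation (inverse w) (rotation w p) = p" for p
      using wnz by (cases p; simp add: rotation_def)+
    then have "bij T" unfolding T by (metis bijI')
    moreover have "blaschke n r \<alpha> (T p) = blaschke n r \<alpha> p" for p
      unfolding fibre T using w by (cases p) (auto simp: P_def rotation_def power_mult_distrib)
    ultimately show "T \<in> covering_transformations (blaschke n r \<alpha>)"
      using sphere_holomorphic_on_rotation[OF wnz]
      by (auto simp: covering_transformations_def conformal_on_def T bij_is_inj bij_is_surj fun_eq_iff)
  qed
qed

section \<open>Sectors as fundamental domains\<close>

theorem theorem3p1:
  fixes n :: nat and r \<alpha> :: real
  assumes "n \<ge> 1" and "0 < r" and "r < 1"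
  shows "(\<forall>D \<in> components (UNIV - (\<Union>k<n. ray n \<alpha> k)).
            fundamental_domain (blaschke n r \<alpha>) (Some ` D) \<and>
            blaschke n r \<alpha> ` (Some ` D) =
              UNIV - (\<lambda>x. Some (complex_of_real x)) ` {r ^ n .. 1 / r ^ n}) \<and>
         covering_transformations (blaschke n r \<alpha>) =
           (\<lambda>j. rotation (unity_root n j)) ` {..<n}"
proof (intro conjI ballI)
  fix D assume "D \<in> components (UNIV - (\<Union>k<n. ray n \<alpha> k))"
  define e where "e = exp (- (\<i> * of_nat n * of_real \<alpha>))"
  have enz: "e \<noteq> 0" by (simp add: e_def)
  have \<rho>: "0 < r ^ n" "r ^ n < 1" using assms by (simp_all add: power_less_one_iff)
  define S where "S = {z. e * z ^ n \<notin> \<real>\<^sub>\<le>\<^sub>0}"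
  \<comment> \<open>The complement of the rays is the preimage \<open>S\<close> of the slit plane
    under the power map.\<close>
  have D: "D \<in> components S"
    using \<open>D \<in> _\<close> unfolding Union_rays_eq[OF assms(1)] S_def e_def
    by (simp add: Compl_eq_Diff_UNIV[symmetric] Collect_neg_eq)
  have bij: "bij_betw (\<lambda>z. e * z ^ n) D (- \<real>\<^sub>\<le>\<^sub>0)"
    by (rule component_power_slit_plane[OF assms(1) enz D[unfolded S_def]])
  have "open ((\<lambda>z. e * z ^ n) -` (- \<real>\<^sub>\<le>\<^sub>0))"
    by (intro open_vimage open_Compl closed_nonpos_Reals_complex continuous_intros)
  then have "open S" by (simp add: S_def vimage_def)
  then have "open D" using D open_components by blast
  let ?B = "blaschke n r \<alpha>"
  have B: "?B (Some z) = disc_involution (r ^ n) (Some (e * z ^ n))" for z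
    by (simp add: blaschke_eq_disc_involution e_def)
  have "?B ` (Some ` D) = disc_involution (r ^ n) ` Some ` (\<lambda>z. e * z ^ n) ` D"
    by (simp add: image_image B)
  also have "\<dots> = UNIV - (\<lambda>x. Some (complex_of_real x)) ` {r ^ n .. 1 / r ^ n}"
    by (simp only: bij_betw_imp_surj_on[OF bij] disc_involution_image_slit_plane[OF \<rho>])
  finally show image: "?B ` (Some ` D) = UNIV - (\<lambda>x. Some (complex_of_real x)) ` {r ^ n .. 1 / r ^ n}" .
  show "fundamental_domain ?B (Some ` D)"
    unfolding fundamental_domain_def sphere_domain_def conformal_on_def
  proof (intro conjI)
    show "openin sphere_topology (Some ` D)" using \<open>open D\<close> by simp
    have "connectedin euclidean D" using D in_components_connected by auto
    then show "connectedin sphere_topology (Some ` D)"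
      by (rule connectedin_continuous_map_image[OF continuous_map_Some])
    show "Some ` D \<noteq> {}" using D in_components_nonempty by auto
    show "inj_on ?B (Some ` D)"
      using bij_betw_imp_inj_on[OF bij] bij_is_inj[OF bij_disc_involution[OF \<rho>]]
      by (intro inj_onI) (auto simp: B inj_eq dest: inj_onD)
    show "\<exists>L. slit L \<and> ?B ` (Some ` D) = UNIV - L"
      \<comment> \<open>\<open>r ^ n < 1\<close> puts the square of \<open>r ^ n\<close> below
        \<open>1\<close>, hence \<open>r ^ n < 1 / r ^ n\<close> and the interval is a nondegenerate
        arc.\<close>
      using image slit_real_interval[of "r ^ n" "1 / r ^ n"] \<rho> mult_strict_mono[of "r ^ n" 1 "r ^ n" 1]
      by (auto simp: field_simps intro!: exI)
    show "sphere_holomorphic_on ?B (Some ` D)"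
    \<comment> \<open>\<open>a\<close> and \<open>d\<close> are the numerator and denominator of the
      involution at \<open>e * z ^ n\<close>; a common zero would force
      \<open>e * z ^ n = r ^ n\<close> and then \<open>r ^ n * r ^ n = 1\<close>.\<close>
    proof (rule sphere_holomorphic_on_quotient[OF \<open>open D\<close>,
        where a = "\<lambda>z. e * z ^ n - of_real (r ^ n)" and d = "\<lambda>z. of_real (r ^ n) * (e * z ^ n) - 1"])
      fix z
      have "of_real (r ^ n) * of_real (r ^ n) \<noteq> (1::complex)"
        using mult_strict_mono[of "r ^ n" 1 "r ^ n" 1] \<rho>
        by (metis less_irrefl of_real_eq_1_iff of_real_mult mult_1 less_imp_le zero_less_one)
      then show "e * z ^ n - of_real (r ^ n) \<noteq> 0 \<or> of_real (r ^ n) * (e * z ^ n) - 1 \<noteq> 0" by force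
    qed (auto simp: B disc_involution_def intro!: holomorphic_intros)
  qed
qed (rule covering_transformations_blaschke[OF assms])

end
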